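(* Let $p$ be a prime and let $r,n\ge 1$ be integers. Let $M$ and $N$ be submodules of the $\mathbb{Z}_{p^r}$-module $\mathbb{Z}_{p^r}^n$ with $N\subseteq M$, $p\text{-}\dim(M)=k$ and $p\text{-}\dim(N)=t$. Then each $p$-basis of $N$ can be extended to a $p$-basis of $M$; that is, for every $p$-basis $(u_1,\dots,u_t)$ of $N$ there is a $p$-basis of $M$ whose set of entries contains $\{u_1,\dots,u_t\}$.
   Context: $\mathbb{Z}_{p^r}$ denotes the ring of integers modulo $p^r$, and $\mathcal{A}_p=\{0,1,\dots,p-1\}\subset\mathbb{Z}_{p^r}$. A $p$-linear combination of vectors $v_1,\dots,v_k\in\mathbb{Z}_{p^r}^n$ is a vector $\sum_{j=1}^k a_jv_j$ with all $a_j\in\mathcal{A}_p$; the set of all of these is $p\text{-span}(v_1,\dots,v_k)$. An ordered sequence $(v_1,\dots,v_k)$ in $\mathbb{Z}_{p^r}^n$ is a $p$-generator sequence if $pv_k=0$ and, for each $1\le i\le k-1$, the vector $pv_i$ is a $p$-linear combination of $v_{i+1},\dots,v_k$. Vectors $v_1,\dots,v_k$ are $p$-linearly independent if, for $a_1,\dots,a_k\in\mathcal{A}_p$, $\sum_{j=1}^k a_jv_j=0$ holds only when all $a_j=0$. A $p$-basis is a $p$-linearly independent $p$-generator sequence; it is a $p$-basis of the submodule $M$ if moreover $M=p\text{-span}(v_1,\dots,v_k)$. (The $p$-span of a $p$-generator sequence is always a submodule, equal to the usual $\mathbb{Z}_{p^r}$-span.) If $M$ has a $p$-basis of length $k$,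 then $|M|=p^k$, so $k$ depends only on $M$; it is called the $p$-dimension of $M$ and denoted $p\text{-}\dim(M)$. Convention: the empty sequence is a $p$-basis of the zero submodule, which has $p$-dimension $0$. *)

theory Defs
  imports "HOL-Analysis.Finite_Cartesian_Product" "Berlekamp_Zassenhaus.Finite_Field"
begin

text \<open>
  The ring of integers modulo \<open>p ^ r\<close> is \<open>'q mod_ring\<close> with \<open>CARD('q) = p ^ r\<close>; the class
  \<open>nontriv\<close> only says \<open>CARD('q) > 1\<close>. Vectors of length \<open>CARD('n)\<close> over it form the type
  \<open>'q mod_ring ^ 'n\<close>, whose submodules are the sets satisfying \<open>Modules.module.subspace (*s)\<close>,
  unfolded by \<open>subspace_mod_ring_vec_iff\<close> below.
\<close>

lemma module_mod_ring_vec: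
  "Modules.module ((*s) :: 'q::nontriv mod_ring \<Rightarrow> 'q mod_ring ^ 'n \<Rightarrow> 'q mod_ring ^ 'n)"
  by unfold_locales (simp_all add: vector_add_ldistrib vector_sadd_rdistrib vector_smult_assoc)

lemma subspace_mod_ring_vec_iff:
  fixes M :: "('q::nontriv mod_ring ^ 'n) set"
  shows "Modules.module.subspace (*s) M \<longleftrightarrow>
    0 \<in> M \<and> (\<forall>x\<in>M. \<forall>y\<in>M. x + y \<in> M) \<and> (\<forall>c. \<forall>x\<in>M. c *s x \<in> M)"
  by (rule Modules.module.subspace_def[OF module_mod_ring_vec])

definition p_digits :: "nat \<Rightarrow> 'q::nontriv mod_ring set" where
  "p_digits p = of_nat ` {0..<p}"

definition p_span :: "nat \<Rightarrow> ('q::nontriv mod_ring ^ 'n) list \<Rightarrow> ('q mod_ring ^ 'n) set" where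
  "p_span p vs =
    {\<Sum>j<length vs. a j *s vs ! j | a :: nat \<Rightarrow> 'q mod_ring. \<forall>j<length vs. a j \<in> p_digits p}"

definition p_generator_seq :: "nat \<Rightarrow> ('q::nontriv mod_ring ^ 'n) list \<Rightarrow> bool" where
  "p_generator_seq p vs \<longleftrightarrow>
    (vs \<noteq> [] \<longrightarrow> of_nat p *s last vs = 0) \<and>
    (\<forall>i. Suc i < length vs \<longrightarrow> of_nat p *s vs ! i \<in> p_span p (drop (Suc i) vs))"

definition p_lin_indep :: "nat \<Rightarrow> ('q::nontriv mod_ring ^ 'n) list \<Rightarrow> bool" where
  "p_lin_indep p vs \<longleftrightarrow>
    (\<forall>a :: nat \<Rightarrow> 'q mod_ring.
      (\<forall>j<length vs. a j \<in> p_digits p) \<longrightarrow>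
      (\<Sum>j<length vs. a j *s vs ! j) = 0 \<longrightarrow>
      (\<forall>j<length vs. a j = 0))"

definition p_basis :: "nat \<Rightarrow> ('q::nontriv mod_ring ^ 'n) list \<Rightarrow> bool" where
  "p_basis p vs \<longleftrightarrow> p_lin_indep p vs \<and> p_generator_seq p vs"

definition p_basis_of ::
    "nat \<Rightarrow> ('q::nontriv mod_ring ^ 'n) set \<Rightarrow> ('q mod_ring ^ 'n) list \<Rightarrow> bool" where
  "p_basis_of p M vs \<longleftrightarrow> p_basis p vs \<and> M = p_span p vs"

text \<open>
  A set with a \<open>p\<close>-basis of length \<open>k\<close> has \<open>p ^ k\<close> elements, so for such a set the length is
  uniquely determined. The value is meaningful only when a \<open>p\<close>-basis exists.
\<close>

definition p_dim :: "nat \<Rightarrow> ('q::nontriv mod_ring ^ 'n) set \<Rightarrow> nat" where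
  "p_dim p M = (THE k. \<exists>vs. p_basis_of p M vs \<and> length vs = k)"

end

theory Submission
  imports Defs
begin

text \<open>
  If \<open>N \<noteq> M\<close>, repeatedly multiplying an element of \<open>M - N\<close> by \<open>p\<close> leads to some \<open>x \<in> M - N\<close> with
  \<open>p x \<in> N\<close>. Putting \<open>x\<close> in front of a \<open>p\<close>-basis of \<open>N\<close> keeps the generator property because
  \<open>p x \<in> N\<close>, and keeps independence because nonzero digits are units, so that a nontrivial relation
  would put \<open>x\<close> into \<open>N\<close>. As \<open>M\<close> is finite, iterating reaches \<open>M\<close>.
\<close>

lemma of_nat_surj_mod_ring:
  fixes c :: "'q::nontriv mod_ring"
  obtains m where "c = of_nat m"
proof -
  have "to_int_mod_ring c \<ge> 0"
    using range_to_int_mod_ring[where 'a='q] by (metis atLeastLessThan_iff rangeI)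
  then have "c = of_nat (nat (to_int_mod_ring c))"
    by (simp add: of_nat_of_int_mod_ring)
  then show thesis by (rule that)
qed

text \<open>A nonzero digit is represented by some \<open>m\<close> with \<open>0 < m < p\<close>.
  The prime \<open>p\<close> does not divide it, so it is coprime to the modulus
  \<open>p ^ r\<close> and hence a unit.\<close>

lemma p_digit_inverse:
  fixes a :: "'q::nontriv mod_ring"
  assumes "prime p" and "CARD('q) = p ^ r" and "a \<in> p_digits p" and "a \<noteq> 0"
  obtains b where "b * a = 1"
proof -
  obtain m where m: "a = of_nat m" "m < p"
    using assms(3) by (auto simp: p_digits_def)
  then have "m \<noteq> 0" using assms(4) by (intro notI) simp
  then have "\<not> p dvd m" using m(2) by (meson dvd_imp_le gr0I not_less)
  then have "coprime m (p ^ r)"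
    using prime_imp_coprime[OF assms(1)] by (simp add: coprime_commute)
  then obtain x y where "m * x = p ^ r * y + 1"
    using \<open>m \<noteq> 0\<close> bezout_nat[of m "p ^ r"] by auto
  \<comment> \<open>The modulus is written as \<open>CARD('q)\<close>, whose image in the ring is 0,
    so only the 1 survives on the right.\<close>
  then have "(of_nat (m * x) :: 'q mod_ring) = of_nat (CARD('q) * y + 1)"
    using assms(2) by simp
  then have "of_nat x * a = 1"
    by (simp add: m(1) mult.commute)
  then show thesis by (rule that)
qed

lemma zero_in_p_digits: "0 < p \<Longrightarrow> 0 \<in> p_digits p"
  unfolding p_digits_def by (rule image_eqI[of _ _ 0]) auto

lemma p_span_Nil: "p_span p [] = {0}"
  by (auto simp: p_span_def)

lemma sum_lessThan_Cons:
  "(\<Sum>j<length (x # us). a j *s (x # us) ! j) = a 0 *s x + (\<Sum>j<length us. a (Suc j) *s us ! j)"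
  by (simp only: length_Cons sum.lessThan_Suc_shift) simp

text \<open>Splitting off the head coefficient replaces indexed sums by a recursion on the list,
  which suits adding one vector at a time.\<close>

lemma p_span_Cons: "p_span p (x # us) = {a *s x + v | a v. a \<in> p_digits p \<and> v \<in> p_span p us}"
proof (intro equalityI subsetI)
  fix w assume "w \<in> p_span p (x # us)"
  then obtain a where "\<forall>j<length (x # us). a j \<in> p_digits p"
    "w = (\<Sum>j<length (x # us). a j *s (x # us) ! j)"
    unfolding p_span_def by blast
  then show "w \<in> {a *s x + v | a v. a \<in> p_digits p \<and> v \<in> p_span p us}"
    unfolding sum_lessThan_Cons p_span_def by force
next
  fix w assume "w \<in> {a *s x + v | a v. a \<in> p_digits p \<and> v \<in> p_span p us}"
  then obtain a b where "a \<in> p_digits p" "\<forall>j<length us. b j \<in> p_digits p"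
    "w = a *s x + (\<Sum>j<length us. b j *s us ! j)"
    unfolding p_span_def by blast
  \<comment> \<open>\<open>case_nat a b\<close> glues the head coefficient \<open>a\<close> to the
    family \<open>b\<close> shifted by one.\<close>
  then have "w = (\<Sum>j<length (x # us). case_nat a b j *s (x # us) ! j)"
    "\<forall>j<length (x # us). case_nat a b j \<in> p_digits p"
    unfolding sum_lessThan_Cons by (auto split: nat.split)
  then show "w \<in> p_span p (x # us)"
    unfolding p_span_def by blast
qed

lemma all_nat_split: "(\<forall>i. P i) \<longleftrightarrow> P 0 \<and> (\<forall>i. P (Suc i))"
  by (metis not0_implies_Suc)

text \<open>Since the span of the empty list is \<open>{0}\<close>, the separate condition on the
  last entry is the same condition as on the others, which gives a uniform recursion.\<close>

lemma p_generator_seq_Cons: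
  "p_generator_seq p (x # us) \<longleftrightarrow> of_nat p *s x \<in> p_span p us \<and> p_generator_seq p us"
proof (cases us)
  case Nil
  then show ?thesis by (simp add: p_generator_seq_def p_span_Nil)
next
  case (Cons y ys)
  have "(\<forall>i. Suc i < length (x # us) \<longrightarrow> of_nat p *s (x # us) ! i \<in> p_span p (drop (Suc i) (x # us)))
    \<longleftrightarrow> of_nat p *s x \<in> p_span p us \<and>
      (\<forall>i. Suc i < length us \<longrightarrow> of_nat p *s us ! i \<in> p_span p (drop (Suc i) us))"
    (is "(\<forall>i. ?P i) \<longleftrightarrow> _")
    unfolding all_nat_split[of ?P] by (simp add: Cons)
  then show ?thesis by (auto simp: p_generator_seq_def Cons)
qed

text \<open>In a relation, the tail sum equals the negative of the head term. The sign stays outside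
  in the hypothesis because the negative of a digit is in general not a digit.\<close>

lemma p_lin_indep_Cons:
  assumes "p_lin_indep p us"
    and "\<And>a. a \<in> p_digits p \<Longrightarrow> - (a *s x) \<in> p_span p us \<Longrightarrow> a = 0"
  shows "p_lin_indep p (x # us)"
  unfolding p_lin_indep_def
proof (intro allI impI)
  fix a j
  assume dig: "\<forall>j<length (x # us). a j \<in> p_digits p"
    and "(\<Sum>j<length (x # us). a j *s (x # us) ! j) = 0" and j: "j < length (x # us)"
  then have eq: "a 0 *s x + (\<Sum>j<length us. a (Suc j) *s us ! j) = 0"
    unfolding sum_lessThan_Cons by simp
  have dig': "\<forall>j<length us. a (Suc j) \<in> p_digits p" using dig by auto
  then have "- (a 0 *s x) \<in> p_span p us"
    unfolding p_span_def minus_unique[OF eq] by (auto intro!: exI[of _ "\<lambda>j. a (Suc j)"])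
  then have a0: "a 0 = 0" using assms(2) dig by auto
  then have "(\<Sum>j<length us. a (Suc j) *s us ! j) = 0" using eq by simp
  then have "\<forall>j<length us. a (Suc j) = 0"
    using assms(1)[unfolded p_lin_indep_def, THEN spec, of "\<lambda>j. a (Suc j)"] dig' by blast
  then show "a j = 0" using a0 j by (cases j) auto
qed

text \<open>Division with remainder by \<open>p\<close> reduces any scalar at \<open>x\<close> to a
  digit; the carry is a multiple of \<open>p x\<close> and is absorbed by the span of
  \<open>us\<close>.\<close>

lemma p_span_Cons_subspace:
  fixes us :: "('q::nontriv mod_ring ^ 'n) list"
  assumes "0 < p" and sub: "Modules.module.subspace (*s) (p_span p us)"
    and px: "of_nat p *s x \<in> p_span p us"
  shows "Modules.module.subspace (*s) (p_span p (x # us))"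
proof -
  note S = sub[unfolded subspace_mod_ring_vec_iff]
  \<comment> \<open>Once \<open>c\<close> ranges over all scalars instead of digits, the closure
    properties are immediate.\<close>
  have eq: "p_span p (x # us) = {c *s x + v | c v. v \<in> p_span p us}"
  proof (intro equalityI subsetI)
    fix w assume "w \<in> {c *s x + v | c v. v \<in> p_span p us}"
    then obtain c v where w: "w = c *s x + v" "v \<in> p_span p us" by blast
    obtain m where m: "c = of_nat m" by (rule of_nat_surj_mod_ring)
    have "c = of_nat (m mod p) + of_nat (m div p) * of_nat p"
      unfolding m of_nat_mult[symmetric] of_nat_add[symmetric] by simp
    then have "w = of_nat (m mod p) *s x + (of_nat (m div p) *s (of_nat p *s x) + v)"
      using w(1) by (simp add: vector_sadd_rdistrib vector_smult_assoc add.assoc)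
    moreover have "of_nat (m div p) *s (of_nat p *s x) + v \<in> p_span p us"
      using S px w(2) by blast
    moreover have "of_nat (m mod p) \<in> p_digits p"
      using assms(1) by (simp add: p_digits_def)
    ultimately show "w \<in> p_span p (x # us)" unfolding p_span_Cons by blast
  qed (auto simp: p_span_Cons)
  show ?thesis
    unfolding subspace_mod_ring_vec_iff
  proof (intro conjI ballI allI)
    show "0 \<in> p_span p (x # us)"
      unfolding eq using S by (auto intro!: exI[of _ 0])
  next
    fix v w assume "v \<in> p_span p (x # us)" "w \<in> p_span p (x # us)"
    then obtain c v' d w' where "v = c *s x + v'" "v' \<in> p_span p us"
      "w = d *s x + w'" "w' \<in> p_span p us"
      unfolding eq by blast
    then have "v + w = (c + d) *s x + (v' + w')" "v' + w' \<in> p_span p us"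
      using S by (auto simp: vector_sadd_rdistrib algebra_simps)
    then show "v + w \<in> p_span p (x # us)" unfolding eq by blast
  next
    fix d v assume "v \<in> p_span p (x # us)"
    then obtain c v' where "v = c *s x + v'" "v' \<in> p_span p us"
      unfolding eq by blast
    then have "d *s v = (d * c) *s x + d *s v'" "d *s v' \<in> p_span p us"
      using S by (auto simp: vector_add_ldistrib vector_smult_assoc)
    then show "d *s v \<in> p_span p (x # us)" unfolding eq by blast
  qed
qed

lemma p_basis_Cons:
  fixes us :: "('q::nontriv mod_ring ^ 'n) list"
  assumes "prime p" and "CARD('q) = p ^ r" and "p_basis p us"
    and "Modules.module.subspace (*s) (p_span p us)"
    and "of_nat p *s x \<in> p_span p us" and "x \<notin> p_span p us"
  shows "p_basis p (x # us)"
proof -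
  note S = assms(4)[unfolded subspace_mod_ring_vec_iff]
  have "a = 0" if dig: "a \<in> p_digits p" and mem: "- (a *s x) \<in> p_span p us" for a
  proof (rule ccontr)
    assume "a \<noteq> 0"
    then obtain b where "b * a = 1"
      using p_digit_inverse[OF assms(1,2) dig] by blast
    \<comment> \<open>Scaling by \<open>- b\<close> undoes both the unit \<open>a\<close> and the
      sign, so \<open>x\<close> itself would lie in the span.\<close>
    then have "(- b) *s (- (a *s x)) = x"
      by (simp add: vec_eq_iff mult.assoc[symmetric])
    moreover have "(- b) *s (- (a *s x)) \<in> p_span p us"
      using S mem by blast
    ultimately show False using assms(6) by simp
  qed
  then show ?thesis
    using assms(3,5) p_lin_indep_Cons[of p us x] by (simp add: p_basis_def p_generator_seq_Cons)
qed

text \<open>Among the vectors \<open>p ^ j *s y\<close>, the one for \<open>j = 0\<close> lies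
  outside \<open>N\<close>, while the one for \<open>j = r\<close> is zero and lies in
  \<open>N\<close>. The last one before an entry into \<open>N\<close> is the required
  \<open>x\<close>.\<close>

lemma exists_p_multiple_in_subspace:
  fixes M N :: "('q::nontriv mod_ring ^ 'n) set"
  assumes "CARD('q) = p ^ r"
    and "Modules.module.subspace (*s) M" and "Modules.module.subspace (*s) N"
    and "y \<in> M" and "y \<notin> N"
  obtains x where "x \<in> M" and "x \<notin> N" and "of_nat p *s x \<in> N"
proof -
  define P where "P j \<longleftrightarrow> of_nat (p ^ j) *s y \<in> N" for j
  have "P r"
    using assms(3) of_nat_card_eq_0[where 'a='q]
    by (simp add: P_def assms(1) subspace_mod_ring_vec_iff del: of_nat_power)
  moreover have "\<not> P 0" using assms(5) by (simp add: P_def)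
  ultimately obtain j where "\<not> P j" "P (Suc j)"
    using nat_induct[of "\<lambda>j. \<not> P j" r] by blast
  then show thesis
    using assms(2,4)
    by (intro that[of "of_nat (p ^ j) *s y"])
      (simp_all add: P_def subspace_mod_ring_vec_iff vector_smult_assoc)
qed

text \<open>New vectors go in front because the generator condition on an entry refers only to later
  entries, so \<open>us\<close> survives as a suffix. The induction is on the number of elements of
  \<open>M\<close> not yet spanned.\<close>

lemma p_basis_extend:
  fixes M :: "('q::nontriv mod_ring ^ 'n) set"
  assumes "prime p" and "CARD('q) = p ^ r" and "Modules.module.subspace (*s) M"
    and "p_basis p us" and "Modules.module.subspace (*s) (p_span p us)" and "p_span p us \<subseteq> M"
  shows "\<exists>ws. p_basis_of p M (ws @ us)"
  using assms(4-6)
proof (induction "card (M - p_span p us)" arbitrary: us rule: less_induct)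
  case less
  have "0 < p" using assms(1) by (rule prime_gt_0_nat)
  show ?case
  proof (cases "M \<subseteq> p_span p us")
    case True
    then show ?thesis using less.prems by (intro exI[of _ "[]"]) (auto simp: p_basis_of_def)
  next
    case False
    then obtain x where x: "x \<in> M" "x \<notin> p_span p us" "of_nat p *s x \<in> p_span p us"
      using exists_p_multiple_in_subspace[OF assms(2,3) less.prems(2)] by blast
    note M = assms(3)[unfolded subspace_mod_ring_vec_iff]
    note S = less.prems(2)[unfolded subspace_mod_ring_vec_iff]
    have "p_span p (x # us) \<subseteq> M"
      unfolding p_span_Cons using M x(1) less.prems(3) by blast
    moreover have "p_span p us \<subseteq> p_span p (x # us)"
      unfolding p_span_Cons using zero_in_p_digits[OF \<open>0 < p\<close>] by force
    moreover have "x \<in> p_span p (x # us)"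
    proof -
      have "1 \<in> p_digits p"
        unfolding p_digits_def using prime_gt_1_nat[OF assms(1)]
        by (intro image_eqI[of _ _ 1]) auto
      then show ?thesis unfolding p_span_Cons using S by force
    qed
    \<comment> \<open>The inclusion is strict because \<open>x\<close> is newly spanned.\<close>
    ultimately have "M - p_span p (x # us) \<subset> M - p_span p us" using x by blast
    then have "card (M - p_span p (x # us)) < card (M - p_span p us)"
      by (intro psubset_card_mono) auto
    then obtain ws where "p_basis_of p M (ws @ x # us)"
      using less.hyps p_basis_Cons[OF assms(1,2) less.prems(1,2) x(3,2)]
        p_span_Cons_subspace[OF \<open>0 < p\<close> less.prems(2) x(3)] \<open>p_span p (x # us) \<subseteq> M\<close>
      by blast
    then show ?thesis by (intro exI[of _ "ws @ [x]"]) simp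
  qed
qed

theorem theorem5:
  fixes p r k t :: nat
    and M N :: "('q::nontriv mod_ring ^ 'n) set"
  assumes "prime p" and "r \<ge> 1" and "CARD('q) = p ^ r"
    and "Modules.module.subspace (*s) M" and "Modules.module.subspace (*s) N" and "N \<subseteq> M"
    and "p_dim p M = k" and "p_dim p N = t"
  shows "\<forall>us. length us = t \<and> p_basis_of p N us \<longrightarrow>
    (\<exists>vs. p_basis_of p M vs \<and> set us \<subseteq> set vs)"
proof (intro allI impI)
  fix us assume "length us = t \<and> p_basis_of p N us"
  then have "p_basis p us" "N = p_span p us" by (auto simp: p_basis_of_def)
  \<comment> \<open>As \<open>N\<close> is the span of \<open>us\<close>, its being a submodule of
    \<open>M\<close> provides what the extension requires of that span.\<close>
  then obtain ws where "p_basis_of p M (ws @ us)"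
    using p_basis_extend[OF assms(1,3,4)] assms(5,6) by blast
  then show "\<exists>vs. p_basis_of p M vs \<and> set us \<subseteq> set vs" by (intro exI[of _ "ws @ us"]) simp
qed

end
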